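(* Let $M$ be a $3\times 3$ matrix with non-negative integer entries. Then $M$ is the substitution matrix of some invertible substitution over the three-letter alphabet $A=\{a,b,c\}$ if and only if $M$ is a finite product of non-negative elementary matrices.
   Context: $A=\{a,b,c\}$; $A^*$ is the free monoid and $\Gamma_A$ the free group on $A$. A substitution over $A$ is a monoid endomorphism $\sigma$ of $A^*$; it is invertible if its natural extension to an endomorphism of $\Gamma_A$ is an automorphism of $\Gamma_A$. Endomorphisms are identified with the triple $(\sigma(a),\sigma(b),\sigma(c))$. For a word $w\in A^*$ and a letter $\alpha\in A$, $|w|_\alpha$ is the number of occurrences of $\alpha$ in $w$. The substitution matrix of $\sigma$ is $$M_\sigma=\begin{pmatrix}|\sigma(a)|_a&|\sigma(b)|_a&|\sigma(c)|_a\\|\sigma(a)|_b&|\sigma(b)|_b&|\sigma(c)|_b\\|\sigma(a)|_c&|\sigma(b)|_c&|\sigma(c)|_c\end{pmatrix}.$$ The non-negative elementary matrices are exactly the substitution matrices of permutations of $A$ (i.e. the $3\times3$ permutation matrices) and of Fibonacci substitutions, where a Fibonacci substitution is one of the form $\pi\circ\phi_l\circ\pi'$ or $\pi\circ\phi_r\circ\pi'$ with $\pi,\pi'$ permutations of $A$ (extended to substitutions), $\phi_l=(ba,b,c)$ and $\phi_r=(ab,b,c)$. *)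

theory Defs
  imports "HOL-Analysis.Analysis" "HOL-Algebra.Group"
begin

section \<open>Free groups\<close>

text \<open>
  A signed letter \<open>(x, True)\<close> stands for \<open>x\<close> and \<open>(x, False)\<close> for \<open>x\<inverse>\<close>. The free group
  on \<open>'a\<close> is the set of freely reduced words in signed letters; the product is concatenation
  followed by free reduction.
\<close>

type_synonym 'a sword = "('a \<times> bool) list"

definition flip :: "'a \<times> bool \<Rightarrow> 'a \<times> bool" where
  "flip l = (fst l, \<not> snd l)"

fun red_cons :: "'a \<times> bool \<Rightarrow> 'a sword \<Rightarrow> 'a sword" where
  "red_cons l [] = [l]"
| "red_cons l (k # w) = (if k = flip l then w else l # k # w)"

definition free_reduce :: "'a sword \<Rightarrow> 'a sword" where
  "free_reduce w = foldr red_cons w []"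

definition freely_reduced :: "'a sword \<Rightarrow> bool" where
  "freely_reduced w \<longleftrightarrow> (\<forall>i. Suc i < length w \<longrightarrow> w ! Suc i \<noteq> flip (w ! i))"

definition free_group :: "'a sword monoid" where
  "free_group = \<lparr>carrier = {w. freely_reduced w}, mult = (\<lambda>u v. free_reduce (u @ v)), one = []\<rparr>"

definition formal_inv :: "'a sword \<Rightarrow> 'a sword" where
  "formal_inv w = rev (map flip w)"

lemma flip_flip [simp]: "flip (flip l) = l"
  by (simp add: flip_def)

lemma flip_neq [simp]: "flip l \<noteq> l"
  by (metis flip_def snd_conv)

lemma freely_reduced_Nil [simp]: "freely_reduced []"
  by (simp add: freely_reduced_def)

lemma freely_reduced_single [simp]: "freely_reduced [l]"
  by (simp add: freely_reduced_def)

lemma freely_reduced_Cons_Cons [simp]: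
  "freely_reduced (l # k # w) \<longleftrightarrow> k \<noteq> flip l \<and> freely_reduced (k # w)"
  unfolding freely_reduced_def
  apply (rule iffI)
   apply force
  apply (clarify, case_tac i; simp)
  done

lemma freely_reduced_tl: "freely_reduced (l # w) \<Longrightarrow> freely_reduced w"
  by (cases w) auto

lemma freely_reduced_red_cons: "freely_reduced w \<Longrightarrow> freely_reduced (red_cons l w)"
  by (cases w) (auto dest: freely_reduced_tl)

lemma red_cons_flip: "freely_reduced w \<Longrightarrow> red_cons l (red_cons (flip l) w) = w"
  by (cases w; cases "tl w") auto

lemma free_reduce_Nil [simp]: "free_reduce [] = []"
  by (simp add: free_reduce_def)

lemma free_reduce_Cons: "free_reduce (l # w) = red_cons l (free_reduce w)"
  by (simp add: free_reduce_def)

lemma freely_reduced_free_reduce [simp]: "freely_reduced (free_reduce w)"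
  by (induction w) (auto simp: free_reduce_Cons freely_reduced_red_cons)

lemma free_reduce_id: "freely_reduced w \<Longrightarrow> free_reduce w = w"
proof (induction w)
  case (Cons l w)
  then show ?case
    by (cases w) (auto simp: free_reduce_Cons dest: freely_reduced_tl)
qed simp

lemma free_reduce_append_right: "free_reduce (u @ free_reduce v) = free_reduce (u @ v)"
  by (induction u) (auto simp: free_reduce_Cons free_reduce_id)

lemma free_reduce_red_cons_append: "free_reduce (red_cons l u @ v) = free_reduce (l # u @ v)"
proof (cases u)
  case (Cons k w)
  then show ?thesis
    using red_cons_flip[of "free_reduce (w @ v)" l] by (auto simp: free_reduce_Cons)
qed simp

lemma free_reduce_append_left: "free_reduce (free_reduce u @ v) = free_reduce (u @ v)"
  by (induction u) (auto simp: free_reduce_Cons free_reduce_red_cons_append)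

lemma formal_inv_Nil [simp]: "formal_inv [] = []"
  by (simp add: formal_inv_def)

lemma formal_inv_append: "formal_inv (u @ v) = formal_inv v @ formal_inv u"
  by (simp add: formal_inv_def)

lemma formal_inv_formal_inv [simp]: "formal_inv (formal_inv w) = w"
  by (simp add: formal_inv_def rev_map comp_def)

lemma free_reduce_cancel: "free_reduce (u @ w @ formal_inv w @ v) = free_reduce (u @ v)"
proof (induction w arbitrary: u v)
  case (Cons l w)
  have "free_reduce (u @ (l # w) @ formal_inv (l # w) @ v)
      = free_reduce ((u @ [l]) @ w @ formal_inv w @ (flip l # v))"
    by (simp add: formal_inv_def)
  also have "\<dots> = free_reduce ((u @ [l]) @ (flip l # v))"
    by (rule Cons.IH)
  also have "\<dots> = free_reduce (u @ free_reduce (l # flip l # v))"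
    by (simp add: free_reduce_append_right)
  also have "\<dots> = free_reduce (u @ v)"
    by (simp add: free_reduce_Cons red_cons_flip free_reduce_append_right)
  finally show ?case .
qed simp

lemma group_free_group: "group (free_group :: 'a sword monoid)"
proof (rule groupI)
  fix x :: "'a sword"
  assume "x \<in> carrier free_group"
  show "\<exists>y\<in>carrier free_group. y \<otimes>\<^bsub>free_group\<^esub> x = \<one>\<^bsub>free_group\<^esub>"
    using free_reduce_cancel[of "[]" "formal_inv x" "[]"]
    by (intro bexI[of _ "free_reduce (formal_inv x)"])
      (simp_all add: free_group_def free_reduce_append_left)
qed (auto simp: free_group_def free_reduce_append_left free_reduce_append_right free_reduce_id)


section \<open>Substitutions\<close>

definition substitution :: "('a list \<Rightarrow> 'a list) \<Rightarrow> bool" where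
  "substitution \<sigma> \<longleftrightarrow> \<sigma> [] = [] \<and> (\<forall>u v. \<sigma> (u @ v) = \<sigma> u @ \<sigma> v)"

definition embed :: "'a list \<Rightarrow> 'a sword" where
  "embed w = map (\<lambda>x. (x, True)) w"

definition sletter_image :: "('a list \<Rightarrow> 'a list) \<Rightarrow> 'a \<times> bool \<Rightarrow> 'a sword" where
  "sletter_image \<sigma> l = (if snd l then embed (\<sigma> [fst l]) else formal_inv (embed (\<sigma> [fst l])))"

definition free_extension :: "('a list \<Rightarrow> 'a list) \<Rightarrow> 'a sword \<Rightarrow> 'a sword" where
  "free_extension \<sigma> w = free_reduce (concat (map (sletter_image \<sigma>) w))"

definition invertible_substitution :: "('a list \<Rightarrow> 'a list) \<Rightarrow> bool" where
  "invertible_substitution \<sigma> \<longleftrightarrow>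
     substitution \<sigma> \<and> free_extension \<sigma> \<in> iso free_group free_group"

text \<open>
  \<^const>\<open>free_extension\<close> is the only endomorphism of the free group that agrees with the
  substitution on positive words, which are embedded injectively.
\<close>

lemma embed_append: "embed (u @ v) = embed u @ embed v"
  by (simp add: embed_def)

lemma inj_embed: "inj embed"
  unfolding embed_def by (rule inj_mapI) (simp add: inj_def)

lemma freely_reduced_embed: "freely_reduced (embed w)"
  by (simp add: freely_reduced_def embed_def flip_def)

lemma embed_in_free_group: "embed w \<in> carrier free_group"
  by (simp add: free_group_def freely_reduced_embed)

lemma sletter_image_flip: "sletter_image \<sigma> (flip l) = formal_inv (sletter_image \<sigma> l)"
  by (auto simp: sletter_image_def flip_def)

lemma free_extension_red_cons: "free_extension \<sigma> (red_cons l w) = free_extension \<sigma> (l # w)"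
  using free_reduce_cancel[of "[]" "sletter_image \<sigma> l"]
  by (cases w) (auto simp: free_extension_def sletter_image_flip)

lemma free_extension_free_reduce: "free_extension \<sigma> (free_reduce w) = free_extension \<sigma> w"
proof (induction w)
  case (Cons l w)
  have "free_extension \<sigma> (l # free_reduce w) = free_extension \<sigma> (l # w)"
    using Cons free_reduce_append_right[of "sletter_image \<sigma> l"]
    by (simp add: free_extension_def) metis
  then show ?case
    by (simp add: free_reduce_Cons free_extension_red_cons)
qed simp

lemma free_extension_hom: "free_extension \<sigma> \<in> hom free_group free_group"
proof (rule homI)
  fix x y :: "'a sword"
  have "free_extension \<sigma> (x @ y) = free_reduce (free_extension \<sigma> x @ free_extension \<sigma> y)"
    by (simp add: free_extension_def free_reduce_append_left free_reduce_append_right)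
  then show "free_extension \<sigma> (x \<otimes>\<^bsub>free_group\<^esub> y)
      = free_extension \<sigma> x \<otimes>\<^bsub>free_group\<^esub> free_extension \<sigma> y"
    by (simp add: free_group_def free_extension_free_reduce)
qed (simp add: free_group_def free_extension_def)

lemma free_extension_embed:
  assumes "substitution \<sigma>"
  shows "free_extension \<sigma> (embed w) = embed (\<sigma> w)"
proof -
  have "concat (map (sletter_image \<sigma>) (embed w)) = embed (\<sigma> w)"
  proof (induction w)
    case (Cons x w)
    have "\<sigma> (x # w) = \<sigma> [x] @ \<sigma> w"
      using assms unfolding substitution_def by (metis append_Cons append_Nil)
    with Cons show ?case
      by (simp add: embed_def sletter_image_def)
  qed (use assms in \<open>simp add: embed_def substitution_def\<close>)
  then show ?thesis
    by (simp add: free_extension_def free_reduce_id freely_reduced_embed)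
qed

lemma free_extension_unique:
  fixes h :: "'a sword \<Rightarrow> 'a sword"
  assumes \<sigma>: "substitution \<sigma>" and h: "h \<in> hom free_group free_group"
    and ext: "\<And>w. h (embed w) = embed (\<sigma> w)" and w: "w \<in> carrier free_group"
  shows "h w = free_extension \<sigma> w"
proof -
  let ?F = "free_group :: 'a sword monoid" and ?g = "free_extension \<sigma>"
  interpret group ?F by (rule group_free_group)
  interpret h: group_hom ?F ?F h
    by (simp add: group_hom_def group_hom_axioms_def h group_free_group)
  interpret g: group_hom ?F ?F ?g
    by (simp add: group_hom_def group_hom_axioms_def free_extension_hom group_free_group)
  have car: "[l] \<in> carrier ?F" for l
    by (simp add: free_group_def)
  have pos: "h [(x, True)] = ?g [(x, True)]" for x
    using ext[of "[x]"] free_extension_embed[OF \<sigma>, of "[x]"] by (simp add: embed_def)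
  have inv: "[(x, False)] = inv\<^bsub>?F\<^esub> [(x, True)]" for x
    by (rule inv_equality[symmetric, OF _ car car])
      (simp add: free_group_def free_reduce_Cons flip_def)
  have single: "h [l] = ?g [l]" for l
  proof (cases l)
    case (Pair x e)
    then show ?thesis
      by (cases e) (simp_all only: pos inv h.hom_inv[OF car] g.hom_inv[OF car])
  qed
  have "freely_reduced w \<Longrightarrow> h w = ?g w"
  proof (induction w)
    case Nil
    show ?case
      using h.hom_one g.hom_one by (simp add: free_group_def)
  next
    case (Cons l w)
    have eq: "l # w = [l] \<otimes>\<^bsub>?F\<^esub> w"
      using Cons.prems by (simp add: free_group_def free_reduce_id)
    have cw: "w \<in> carrier ?F" and ih: "h w = ?g w"
      using Cons freely_reduced_tl[of l w] by (simp_all add: free_group_def)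
    show ?case
      unfolding eq h.hom_mult[OF car cw] g.hom_mult[OF car cw] ih single ..
  qed
  with w show ?thesis
    by (simp add: free_group_def)
qed


section \<open>The three-letter alphabet\<close>

datatype letter = La | Lb | Lc

definition triple :: "letter list \<Rightarrow> letter list \<Rightarrow> letter list \<Rightarrow> letter list \<Rightarrow> letter list" where
  "triple u v w x = concat (map (case_letter u v w) x)"

lemma substitution_triple: "substitution (triple u v w)"
  by (simp add: substitution_def triple_def)

lemma substitution_eq_triple:
  assumes "substitution \<sigma>"
  shows "\<sigma> = triple (\<sigma> [La]) (\<sigma> [Lb]) (\<sigma> [Lc])"
proof
  fix w
  show "\<sigma> w = triple (\<sigma> [La]) (\<sigma> [Lb]) (\<sigma> [Lc]) w"
  proof (induction w)
    case (Cons x w)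
    have "\<sigma> (x # w) = \<sigma> [x] @ \<sigma> w"
      using assms unfolding substitution_def by (metis append_Cons append_Nil)
    with Cons show ?case
      by (cases x) (simp_all add: triple_def)
  qed (use assms in \<open>simp add: triple_def substitution_def\<close>)
qed

text \<open>The rows are listed: row \<open>i\<close>, column \<open>j\<close> holds the number of \<open>i\<close>'s in \<open>\<sigma> [j]\<close>.\<close>

definition subst_matrix :: "(letter list \<Rightarrow> letter list) \<Rightarrow> nat^3^3" where
  "subst_matrix \<sigma> = vector
     [vector [count_list (\<sigma> [La]) La, count_list (\<sigma> [Lb]) La, count_list (\<sigma> [Lc]) La],
      vector [count_list (\<sigma> [La]) Lb, count_list (\<sigma> [Lb]) Lb, count_list (\<sigma> [Lc]) Lb],
      vector [count_list (\<sigma> [La]) Lc, count_list (\<sigma> [Lb]) Lc, count_list (\<sigma> [Lc]) Lc]]"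

definition permutation_substitution :: "(letter list \<Rightarrow> letter list) \<Rightarrow> bool" where
  "permutation_substitution \<sigma> \<longleftrightarrow> (\<exists>p. bij p \<and> \<sigma> = map p)"

definition phi_l :: "letter list \<Rightarrow> letter list" where
  "phi_l = triple [Lb, La] [Lb] [Lc]"

definition phi_r :: "letter list \<Rightarrow> letter list" where
  "phi_r = triple [La, Lb] [Lb] [Lc]"

definition fibonacci_substitution :: "(letter list \<Rightarrow> letter list) \<Rightarrow> bool" where
  "fibonacci_substitution \<sigma> \<longleftrightarrow>
     (\<exists>\<pi> \<pi>'. permutation_substitution \<pi> \<and> permutation_substitution \<pi>' \<and>
        (\<sigma> = \<pi> \<circ> phi_l \<circ> \<pi>' \<or> \<sigma> = \<pi> \<circ> phi_r \<circ> \<pi>'))"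

definition nonneg_elementary_matrix :: "nat^3^3 \<Rightarrow> bool" where
  "nonneg_elementary_matrix E \<longleftrightarrow>
     (\<exists>\<sigma>. (permutation_substitution \<sigma> \<or> fibonacci_substitution \<sigma>) \<and> E = subst_matrix \<sigma>)"

definition matrix_prod :: "(nat^3^3) list \<Rightarrow> nat^3^3" where
  "matrix_prod Es = foldr (**) Es (mat 1)"

end

theory Submission
  imports Defs
begin

text \<open>
  One direction is direct: permutations and Fibonacci substitutions are invertible, invertible
  substitutions are closed under composition, and the matrix of a composition is the product of
  the matrices.

  For the other direction, let \<open>\<sigma>\<close> be invertible, and argue by induction on the total length of
  its three images. If each image is a single letter, \<open>\<sigma>\<close> is a permutation. Otherwise two
  letters \<open>l \<noteq> k\<close> are found such that, up to conjugation, every \<open>l\<close> in every image is immediately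
  followed by \<open>k\<close> (or every \<open>l\<close> is immediately preceded by \<open>k\<close>). Conjugation by a letter
  rotates the images and so changes neither invertibility nor the matrix. Afterwards \<open>\<sigma>\<close> is the
  Fibonacci substitution \<open>l \<mapsto> lk\<close> (or \<open>l \<mapsto> kl\<close>) composed with a shorter substitution, again
  invertible, and induction applies (\<open>peel_letter\<close>).

  The letters \<open>l\<close> and \<open>k\<close> come from Stallings foldings, in the spirit of the proof of Whitehead's
  cut-vertex lemma by Heusener and Weidmann. Write the three images on the petals of a rose. This
  is a directed graph with labelled edges in which each image is a closed walk, and it has at most
  two more edges than vertices. Folding two equally labelled edges with a common source or a common
  target removes a vertex and at least one edge, so this bound persists. A graph in which no
  folding is possible lets a walk be followed through free reductions; as the images generate the
  free group, each letter is then a loop at the base point, and there is only one vertex. Hence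
  the folding can be continued down to a graph that has two vertices and at most four edges and
  is not folded (\<open>two_vertex_quotient\<close>). One letter labels two edges of that graph, and each other
  letter labels exactly one; a short case analysis (\<open>two_vertex_fork\<close>) shows that some letter
  \<open>l\<close> always leads to a vertex that only a letter \<open>k \<noteq> l\<close> leaves, or the same with all arrows
  reversed. All the images are walks in this graph, so \<open>l\<close> is always followed by \<open>k\<close> in them.
\<close>

section \<open>Invertible substitutions as bijections\<close>

lemma substitution_Cons: "substitution \<sigma> \<Longrightarrow> \<sigma> (x # w) = \<sigma> [x] @ \<sigma> w"
  unfolding substitution_def by (metis append_Cons append_Nil)

lemma substitution_Nil: "substitution \<sigma> \<Longrightarrow> \<sigma> [] = []"
  by (simp add: substitution_def)

lemma substitution_append: "substitution \<sigma> \<Longrightarrow> \<sigma> (u @ v) = \<sigma> u @ \<sigma> v"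
  by (simp add: substitution_def)

lemma substitution_eqI:
  assumes "substitution \<sigma>" "substitution \<tau>" "\<And>x. \<sigma> [x] = \<tau> [x]"
  shows "\<sigma> = \<tau>"
proof
  fix w show "\<sigma> w = \<tau> w"
  proof (induction w)
    case (Cons x w)
    then show ?case
      using substitution_Cons[OF assms(1), of x w] substitution_Cons[OF assms(2), of x w] assms(3)
      by simp
  qed (simp add: assms(1,2) substitution_Nil)
qed

lemma substitution_comp: "substitution \<sigma> \<Longrightarrow> substitution \<tau> \<Longrightarrow> substitution (\<sigma> \<circ> \<tau>)"
  by (simp add: substitution_def)

lemma substitution_concat_map: "substitution (\<lambda>w. concat (map g w))"
  by (simp add: substitution_def)

lemma substitution_map: "substitution (map p)"
  by (simp add: substitution_def)

lemma embed_Nil [simp]: "embed [] = []"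
  by (simp add: embed_def)

lemma embed_Cons [simp]: "embed (x # w) = (x, True) # embed w"
  by (simp add: embed_def)

lemma free_extension_in_carrier: "free_extension \<sigma> w \<in> carrier free_group"
  by (simp add: free_extension_def free_group_def)

lemma invertible_iff_bij_betw:
  "invertible_substitution \<sigma> \<longleftrightarrow>
     substitution \<sigma> \<and> bij_betw (free_extension \<sigma>) (carrier free_group) (carrier free_group)"
  by (auto simp: invertible_substitution_def iso_def free_extension_hom)

lemma free_extension_id:
  assumes "w \<in> carrier free_group"
  shows "free_extension id w = w"
proof -
  have "concat (map (sletter_image id) w) = w"
    by (induction w) (auto simp: sletter_image_def formal_inv_def flip_def)
  with assms show ?thesis
    by (simp add: free_extension_def free_group_def free_reduce_id)
qed

lemma free_extension_comp:
  assumes "substitution \<sigma>" "substitution \<tau>" "w \<in> carrier free_group"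
  shows "free_extension (\<sigma> \<circ> \<tau>) w = free_extension \<sigma> (free_extension \<tau> w)"
proof -
  have "(free_extension \<sigma> \<circ> free_extension \<tau>) w = free_extension (\<sigma> \<circ> \<tau>) w"
  proof (rule free_extension_unique[OF substitution_comp[OF assms(1,2)] _ _ assms(3)])
    show "free_extension \<sigma> \<circ> free_extension \<tau> \<in> hom free_group free_group"
      by (rule hom_compose[OF free_extension_hom free_extension_hom])
    show "(free_extension \<sigma> \<circ> free_extension \<tau>) (embed w) = embed ((\<sigma> \<circ> \<tau>) w)" for w
      by (simp add: free_extension_embed assms)
  qed
  then show ?thesis by simp
qed

lemma bij_betw_free_extension_comp:
  assumes "substitution \<sigma>" "substitution \<tau>"
  shows "bij_betw (free_extension (\<sigma> \<circ> \<tau>)) (carrier free_group) (carrier free_group) \<longleftrightarrow>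
    bij_betw (free_extension \<sigma> \<circ> free_extension \<tau>) (carrier free_group) (carrier free_group)"
  by (rule bij_betw_cong) (simp add: free_extension_comp assms)

lemma invertible_substitution_comp:
  assumes "invertible_substitution \<sigma>" "invertible_substitution \<tau>"
  shows "invertible_substitution (\<sigma> \<circ> \<tau>)"
  using assms bij_betw_trans
  by (fastforce simp: invertible_iff_bij_betw bij_betw_free_extension_comp substitution_comp)

text \<open>
  Once an invertible substitution has been split off on the left, the remaining factor is
  invertible too; this keeps the induction on the total length going.
\<close>

lemma invertible_substitution_cancel_left:
  assumes "invertible_substitution \<sigma>" "substitution \<tau>" "invertible_substitution (\<sigma> \<circ> \<tau>)"
  shows "invertible_substitution \<tau>"
proof -
  have "free_extension \<tau> ` carrier free_group \<subseteq> carrier free_group"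
    by (auto simp: free_extension_in_carrier)
  then show ?thesis
    using assms bij_betw_comp_iff2[of "free_extension \<sigma>" "carrier free_group" "carrier free_group"
        "free_extension \<tau>" "carrier free_group"]
    by (simp add: invertible_iff_bij_betw bij_betw_free_extension_comp)
qed

lemma invertible_substitution_id: "invertible_substitution id"
proof -
  let ?F = "free_group :: 'a sword monoid"
  have "bij_betw (free_extension id) (carrier ?F) (carrier ?F) \<longleftrightarrow>
      bij_betw id (carrier ?F) (carrier ?F)"
    by (rule bij_betw_cong) (simp add: free_extension_id)
  then show ?thesis
    by (simp add: invertible_iff_bij_betw substitution_def)
qed

lemma invertible_substitution_permutation:
  assumes "bij p"
  shows "invertible_substitution (map p)"
proof -
  have cancel: "free_extension (map q) (free_extension (map r) w) = w"
    if "q \<circ> r = id" "w \<in> carrier free_group" for q r :: "'a \<Rightarrow> 'a" and w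
  proof -
    have "map q \<circ> map r = id"
      using that(1) by (metis list.map_comp list.map_id comp_apply id_apply ext)
    then show ?thesis
      using free_extension_comp[of "map q" "map r" w] that(2)
      by (simp add: substitution_map free_extension_id)
  qed
  have "p \<circ> inv_into UNIV p = id" "inv_into UNIV p \<circ> p = id"
    using assms by (auto simp: bij_is_inj bij_is_surj surj_f_inv_f fun_eq_iff)
  then have "bij_betw (free_extension (map p)) (carrier free_group) (carrier free_group)"
    by (intro bij_betw_byWitness[where f' = "free_extension (map (inv_into UNIV p))"])
      (auto simp: cancel free_extension_in_carrier)
  then show ?thesis
    by (simp add: invertible_iff_bij_betw substitution_map)
qed

section \<open>Attaching a letter to another one\<close>

definition append_letter :: "'a \<Rightarrow> 'a \<Rightarrow> 'a list \<Rightarrow> 'a list" where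
  "append_letter l k w = concat (map (\<lambda>x. if x = l then [l, k] else [x]) w)"

definition prepend_letter :: "'a \<Rightarrow> 'a \<Rightarrow> 'a list \<Rightarrow> 'a list" where
  "prepend_letter l k w = concat (map (\<lambda>x. if x = l then [k, l] else [x]) w)"

lemma append_letter_Nil [simp]: "append_letter l k [] = []"
  by (simp add: append_letter_def)

lemma append_letter_Cons [simp]:
  "append_letter l k (x # w) = (if x = l then [l, k] else [x]) @ append_letter l k w"
  by (simp add: append_letter_def)

lemma prepend_letter_Nil [simp]: "prepend_letter l k [] = []"
  by (simp add: prepend_letter_def)

lemma prepend_letter_Cons [simp]:
  "prepend_letter l k (x # w) = (if x = l then [k, l] else [x]) @ prepend_letter l k w"
  by (simp add: prepend_letter_def)

lemma substitution_append_letter: "substitution (append_letter l k)"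
  unfolding append_letter_def [abs_def] by (rule substitution_concat_map)

lemma substitution_prepend_letter: "substitution (prepend_letter l k)"
  unfolding prepend_letter_def [abs_def] by (rule substitution_concat_map)

lemma rev_append_letter: "rev (append_letter l k w) = prepend_letter l k (rev w)"
  by (induction w) (auto simp: substitution_append[OF substitution_prepend_letter])

text \<open>
  The automorphism that inverts the single generator \<open>k\<close>. Conjugating \<open>l \<mapsto> lk\<close> by it yields
  \<open>l \<mapsto> l k\<inverse>\<close>, so it gives the inverse of a Fibonacci substitution although that inverse is not
  a substitution.
\<close>

definition invert_letter :: "'a \<Rightarrow> 'a sword \<Rightarrow> 'a sword" where
  "invert_letter k w = map (\<lambda>(x, s). (x, s \<noteq> (x = k))) w"

lemma invert_letter_invert_letter [simp]: "invert_letter k (invert_letter k w) = w"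
  by (induction w) (auto simp: invert_letter_def)

lemma invert_letter_red_cons:
  "invert_letter k (red_cons l w) = red_cons (case l of (x, s) \<Rightarrow> (x, s \<noteq> (x = k))) (invert_letter k w)"
  by (cases w) (auto simp: invert_letter_def flip_def split: prod.splits)

lemma invert_letter_free_reduce: "invert_letter k (free_reduce w) = free_reduce (invert_letter k w)"
  by (induction w)
    (auto simp: free_reduce_Cons invert_letter_red_cons, auto simp: invert_letter_def free_reduce_Cons)

lemma invert_letter_in_carrier:
  assumes "w \<in> carrier free_group"
  shows "invert_letter k w \<in> carrier free_group"
  using assms invert_letter_free_reduce[of k w]
    freely_reduced_free_reduce[of "invert_letter k w"]
  by (simp add: free_group_def free_reduce_id)

lemma invert_letter_hom: "invert_letter k \<in> hom free_group free_group"
  by (rule homI)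
    (auto simp: invert_letter_in_carrier, simp add: free_group_def invert_letter_free_reduce,
     simp add: invert_letter_def)

lemma free_group_hom_eq_idI:
  assumes h: "h \<in> hom free_group free_group" and pos: "\<And>x. h [(x, True)] = [(x, True)]"
    and w: "w \<in> carrier free_group"
  shows "h w = w"
proof -
  let ?F = "free_group :: 'a sword monoid"
  interpret h: group_hom ?F ?F h
    by (simp add: group_hom_def group_hom_axioms_def h group_free_group)
  have "h (embed v) = embed (id v)" for v
  proof (induction v)
    case Nil
    then show ?case using h.hom_one by (simp add: free_group_def)
  next
    case (Cons x v)
    have eq: "embed (x # v) = [(x, True)] \<otimes>\<^bsub>?F\<^esub> embed v"
      using freely_reduced_embed[of "x # v"] by (simp add: free_group_def free_reduce_id)
    have "[(x, True)] \<in> carrier ?F"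
      by (simp add: free_group_def)
    then have "h (embed (x # v)) = [(x, True)] \<otimes>\<^bsub>?F\<^esub> embed v"
      unfolding eq using h.hom_mult[of "[(x, True)]" "embed v"] embed_in_free_group[of v] Cons
      by (simp add: pos)
    then show ?case by (simp only: eq[symmetric] id_apply)
  qed
  then have "h w = free_extension id w"
    by (intro free_extension_unique[OF _ h _ w]) (simp_all add: substitution_def)
  with w show ?thesis by (simp add: free_extension_id)
qed

text \<open>
  With \<open>\<iota> = invert_letter k\<close> the hypothesis says that \<open>h \<circ> \<iota> \<circ> h \<circ> \<iota>\<close> is the identity. As \<open>\<iota>\<close> is
  an involution, \<open>\<iota> \<circ> h \<circ> \<iota>\<close> is then a two-sided inverse of \<open>h\<close>.
\<close>

lemma bij_betw_of_hom_conj: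
  assumes h: "h \<in> hom free_group free_group"
    and pos: "\<And>x. h (invert_letter k (h (invert_letter k [(x, True)]))) = [(x, True)]"
  shows "bij_betw h (carrier free_group) (carrier free_group)"
proof -
  have h_in: "h w \<in> carrier free_group" if "w \<in> carrier free_group" for w
    using h that by (auto simp: hom_def)
  have "h \<circ> (invert_letter k \<circ> (h \<circ> invert_letter k)) \<in> hom free_group free_group"
    by (intro hom_compose[OF _ h] hom_compose[OF _ invert_letter_hom] invert_letter_hom)
  then have right: "h (invert_letter k (h (invert_letter k w))) = w"
    if "w \<in> carrier free_group" for w
    using free_group_hom_eq_idI[of _ w] pos that by (metis comp_apply)
  have left: "invert_letter k (h (invert_letter k (h w))) = w" if "w \<in> carrier free_group" for w
    using right[OF invert_letter_in_carrier[OF that], of k] by (metis invert_letter_invert_letter)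
  show ?thesis
    by (rule bij_betw_byWitness[where f' = "\<lambda>w. invert_letter k (h (invert_letter k w))"])
      (auto simp: left right h_in invert_letter_in_carrier)
qed

lemma invertible_append_letter:
  assumes "l \<noteq> k"
  shows "invertible_substitution (append_letter l k)"
proof -
  have "bij_betw (free_extension (append_letter l k)) (carrier free_group) (carrier free_group)"
    by (rule bij_betw_of_hom_conj[OF free_extension_hom, of _ k])
      (use assms in \<open>auto simp: invert_letter_def free_extension_def sletter_image_def
         formal_inv_def flip_def free_reduce_Cons\<close>)
  then show ?thesis
    by (simp add: invertible_iff_bij_betw substitution_append_letter)
qed

lemma invertible_prepend_letter:
  assumes "l \<noteq> k"
  shows "invertible_substitution (prepend_letter l k)"
proof -
  have "bij_betw (free_extension (prepend_letter l k)) (carrier free_group) (carrier free_group)"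
    by (rule bij_betw_of_hom_conj[OF free_extension_hom, of _ k])
      (use assms in \<open>auto simp: invert_letter_def free_extension_def sletter_image_def
         formal_inv_def flip_def free_reduce_Cons\<close>)
  then show ?thesis
    by (simp add: invertible_iff_bij_betw substitution_prepend_letter)
qed

section \<open>Conjugate substitutions\<close>

lemma free_reduce_congruence:
  "free_reduce (u @ free_reduce v @ w) = free_reduce (u @ v @ w)"
  by (metis free_reduce_append_left free_reduce_append_right)

lemma bij_betw_conjugation:
  "bij_betw (\<lambda>w. free_reduce (formal_inv c @ w @ c)) (carrier free_group) (carrier free_group)"
proof (rule bij_betw_byWitness[where f' = "\<lambda>w. free_reduce (c @ w @ formal_inv c)"])
  show "\<forall>w\<in>carrier free_group. free_reduce (c @ free_reduce (formal_inv c @ w @ c) @ formal_inv c) = w"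
  proof
    fix w :: "'a sword" assume "w \<in> carrier free_group"
    have "free_reduce (c @ free_reduce (formal_inv c @ w @ c) @ formal_inv c)
      = free_reduce ((c @ formal_inv c @ w) @ c @ formal_inv c @ [])"
      unfolding free_reduce_congruence by simp
    also have "\<dots> = free_reduce ([] @ c @ formal_inv c @ w)"
      using free_reduce_cancel[of "c @ formal_inv c @ w" c "[]"] by simp
    also have "\<dots> = w"
      unfolding free_reduce_cancel using \<open>w \<in> _\<close> by (simp add: free_group_def free_reduce_id)
    finally show "free_reduce (c @ free_reduce (formal_inv c @ w @ c) @ formal_inv c) = w" .
  qed
  show "\<forall>w\<in>carrier free_group. free_reduce (formal_inv c @ free_reduce (c @ w @ formal_inv c) @ c) = w"
  proof
    fix w :: "'a sword" assume "w \<in> carrier free_group"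
    have "free_reduce (formal_inv c @ free_reduce (c @ w @ formal_inv c) @ c)
      = free_reduce ((formal_inv c @ c @ w) @ formal_inv c @ formal_inv (formal_inv c) @ [])"
      unfolding free_reduce_congruence by simp
    also have "\<dots> = free_reduce ([] @ formal_inv c @ formal_inv (formal_inv c) @ w)"
      using free_reduce_cancel[of "formal_inv c @ c @ w" "formal_inv c" "[]"] by simp
    also have "\<dots> = w"
      unfolding free_reduce_cancel using \<open>w \<in> _\<close> by (simp add: free_group_def free_reduce_id)
    finally show "free_reduce (formal_inv c @ free_reduce (c @ w @ formal_inv c) @ c) = w" .
  qed
qed (auto simp: free_group_def)

lemma conjugation_hom: "(\<lambda>w. free_reduce (formal_inv c @ w @ c)) \<in> hom free_group free_group"
proof (rule homI)
  fix x y :: "'a sword"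
  have "free_reduce (formal_inv c @ free_reduce (x @ y) @ c) = free_reduce ((formal_inv c @ x) @ y @ c)"
    unfolding free_reduce_congruence by simp
  also have "\<dots> = free_reduce ((formal_inv c @ x) @ c @ formal_inv c @ (y @ c))"
    unfolding free_reduce_cancel ..
  also have "\<dots> = free_reduce (free_reduce (formal_inv c @ x @ c) @ free_reduce (formal_inv c @ y @ c))"
    by (simp add: free_reduce_append_left free_reduce_append_right)
  finally show "free_reduce (formal_inv c @ (x \<otimes>\<^bsub>free_group\<^esub> y) @ c) =
      free_reduce (formal_inv c @ x @ c) \<otimes>\<^bsub>free_group\<^esub> free_reduce (formal_inv c @ y @ c)"
    by (simp add: free_group_def)
qed (simp add: free_group_def)

text \<open>
  The relation between the images of letters extends to all words, so on the free group
  \<open>\<tau>\<close> is \<open>\<sigma>\<close> followed by the inner automorphism \<open>w \<mapsto> k\<inverse> w k\<close>.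
\<close>

lemma invertible_conjugate_iff:
  assumes \<sigma>: "substitution \<sigma>" and \<tau>: "substitution \<tau>"
    and conj: "\<And>x. \<sigma> [x] @ [k] = k # \<tau> [x]"
  shows "invertible_substitution \<sigma> \<longleftrightarrow> invertible_substitution \<tau>"
proof -
  let ?h = "\<lambda>w. free_reduce (formal_inv [(k, True)] @ w @ [(k, True)])"
  have conj': "\<sigma> w @ [k] = k # \<tau> w" for w
  proof (induction w)
    case (Cons x w)
    have "\<sigma> (x # w) @ [k] = (\<sigma> [x] @ [k]) @ \<tau> w"
      using Cons substitution_Cons[OF \<sigma>, of x w] by simp
    also have "\<dots> = k # \<tau> (x # w)"
      using substitution_Cons[OF \<tau>, of x w] by (simp only: conj append_Cons)
    finally show ?case .
  qed (simp add: substitution_Nil \<sigma> \<tau>)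
  have "(?h \<circ> free_extension \<sigma>) w = free_extension \<tau> w" if "w \<in> carrier free_group" for w
  proof (rule free_extension_unique[OF \<tau> _ _ that])
    show "?h \<circ> free_extension \<sigma> \<in> hom free_group free_group"
      by (rule hom_compose[OF free_extension_hom conjugation_hom])
    fix v
    have "embed (\<sigma> v) @ [(k, True)] = (k, True) # embed (\<tau> v)"
      using arg_cong[OF conj'[of v], of embed] by (simp add: embed_append)
    then have "(?h \<circ> free_extension \<sigma>) (embed v)
      = free_reduce ([] @ formal_inv [(k, True)] @ formal_inv (formal_inv [(k, True)]) @ embed (\<tau> v))"
      by (simp add: free_extension_embed \<sigma>)
    then show "(?h \<circ> free_extension \<sigma>) (embed v) = embed (\<tau> v)"
      unfolding free_reduce_cancel by (simp add: free_reduce_id freely_reduced_embed)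
  qed
  then have "bij_betw (free_extension \<tau>) (carrier free_group) (carrier free_group) \<longleftrightarrow>
    bij_betw (?h \<circ> free_extension \<sigma>) (carrier free_group) (carrier free_group)"
    by (intro bij_betw_cong) simp
  also have "\<dots> \<longleftrightarrow> bij_betw (free_extension \<sigma>) (carrier free_group) (carrier free_group)"
    by (rule bij_betw_comp_iff2[symmetric, OF bij_betw_conjugation])
      (auto simp: free_extension_in_carrier)
  finally show ?thesis
    by (simp add: invertible_iff_bij_betw \<sigma> \<tau>)
qed

section \<open>Walks in labelled graphs\<close>

text \<open>
  An inverse letter is read by traversing an edge against its direction.
\<close>

fun walk :: "('v \<times> 'a \<times> 'v) set \<Rightarrow> 'v \<Rightarrow> 'a sword \<Rightarrow> 'v \<Rightarrow> bool" where
  "walk E v [] v' \<longleftrightarrow> v = v'"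
| "walk E v ((x, s) # w) v' \<longleftrightarrow>
     (\<exists>m. (if s then (v, x, m) \<in> E else (m, x, v) \<in> E) \<and> walk E m w v')"

definition folded :: "('v \<times> 'a \<times> 'v) set \<Rightarrow> bool" where
  "folded E \<longleftrightarrow>
     (\<forall>s x t t'. (s, x, t) \<in> E \<longrightarrow> (s, x, t') \<in> E \<longrightarrow> t = t') \<and>
     (\<forall>s s' x t. (s, x, t) \<in> E \<longrightarrow> (s', x, t) \<in> E \<longrightarrow> s = s')"

lemma walk_append: "walk E v (u @ w) v' \<longleftrightarrow> (\<exists>m. walk E v u m \<and> walk E m w v')"
proof (induction u arbitrary: v)
  case (Cons l u)
  then show ?case by (cases l) auto
qed simp

lemma walk_formal_inv: "walk E v w v' \<Longrightarrow> walk E v' (formal_inv w) v"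
proof (induction w arbitrary: v)
  case (Cons l w)
  obtain x s where l: "l = (x, s)" by (cases l)
  from Cons.prems obtain m where m: "if s then (v, x, m) \<in> E else (m, x, v) \<in> E" "walk E m w v'"
    by (auto simp: l)
  have "walk E v' (formal_inv w @ [flip l]) v"
    unfolding walk_append using Cons.IH[OF m(2)] m(1) by (auto simp: l flip_def)
  then show ?case by (simp add: formal_inv_def)
qed (simp add: formal_inv_def)

text \<open>
  In a folded graph, reading a letter and then its inverse leads back to the start.
\<close>

lemma walk_red_cons: "folded E \<Longrightarrow> walk E v (l # w) v' \<Longrightarrow> walk E v (red_cons l w) v'"
  by (cases l; cases w) (auto simp: folded_def flip_def split: if_splits; blast)+

lemma walk_free_reduce: "folded E \<Longrightarrow> walk E v w v' \<Longrightarrow> walk E v (free_reduce w) v'"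
proof (induction w arbitrary: v)
  case (Cons l w)
  obtain x s where l: "l = (x, s)" by (cases l)
  from Cons.prems Cons.IH have "walk E v (l # free_reduce w) v'"
    by (auto simp: l)
  then show ?case
    unfolding free_reduce_Cons by (rule walk_red_cons[OF Cons.prems(1)])
qed simp

lemma walk_free_extension:
  assumes "folded E" "\<And>x. walk E b (embed (\<sigma> [x])) b"
  shows "walk E b (free_extension \<sigma> w) b"
proof -
  have "walk E b (sletter_image \<sigma> l) b" for l
    using assms(2) walk_formal_inv[OF assms(2)] by (simp add: sletter_image_def)
  then have "walk E b (concat (map (sletter_image \<sigma>) w)) b"
    by (induction w) (auto simp: walk_append)
  then show ?thesis
    unfolding free_extension_def by (rule walk_free_reduce[OF assms(1)])
qed

lemma free_extension_surj:
  assumes "invertible_substitution \<sigma>"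
  shows "\<exists>w. free_extension \<sigma> w = [(x, True)]"
proof -
  have "[(x, True)] \<in> carrier free_group"
    by (simp add: free_group_def)
  then show ?thesis
    using assms by (force simp: invertible_iff_bij_betw bij_betw_def)
qed

text \<open>
  Free reduction creates no letters, so a letter missing in all the images would be missing in
  the whole image of the extension.
\<close>

lemma invertible_letter_occurs:
  assumes "invertible_substitution \<sigma>"
  shows "\<exists>y. x \<in> set (\<sigma> [y])"
proof (rule ccontr)
  assume no: "\<nexists>y. x \<in> set (\<sigma> [y])"
  have sub: "fst ` set (red_cons l w) \<subseteq> insert (fst l) (fst ` set w)" for l and w :: "'a sword"
    by (cases w) auto
  have red: "fst ` set (free_reduce w) \<subseteq> fst ` set w" for w :: "'a sword"
  proof (induction w)
    case (Cons l w)
    then show ?case using sub[of l "free_reduce w"] by (simp add: free_reduce_Cons) blast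
  qed simp
  have "x \<notin> fst ` set (sletter_image \<sigma> l)" for l
    using no by (auto simp: sletter_image_def embed_def formal_inv_def flip_def)
  then have "x \<notin> fst ` set (concat (map (sletter_image \<sigma>) w))" for w
    by (induction w) (simp_all add: image_Un)
  then have "x \<notin> fst ` set (free_extension \<sigma> w)" for w
    using red unfolding free_extension_def by blast
  with free_extension_surj[OF assms, of x] show False
    by (metis fst_conv image_eqI list.set_intros(1))
qed

lemma invertible_image_nonempty:
  assumes "invertible_substitution \<sigma>"
  shows "\<sigma> [x] \<noteq> []"
proof
  assume "\<sigma> [x] = []"
  then have "free_extension \<sigma> (embed [x]) = free_extension \<sigma> (embed [])"
    using assms unfolding invertible_iff_bij_betw
    by (metis free_extension_embed substitution_Nil)
  then have "embed [x] = embed []"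
    using assms embed_in_free_group unfolding invertible_iff_bij_betw bij_betw_def
    by (metis inj_onD)
  then show False by simp
qed

section \<open>Folding the rose\<close>

text \<open>
  Position \<open>i\<close> of the word \<open>W\<close> is the vertex \<open>f i\<close>. All quotients of the line spelling \<open>W\<close> are
  obtained by varying \<open>f\<close>, so identifying vertices amounts to composing \<open>f\<close> with a map.
\<close>

definition edges :: "'a list \<Rightarrow> (nat \<Rightarrow> 'v) \<Rightarrow> ('v \<times> 'a \<times> 'v) set" where
  "edges W f = (\<lambda>i. (f i, W ! i, f (Suc i))) ` {..<length W}"

lemma finite_edges [simp]: "finite (edges W f)"
  by (simp add: edges_def)

lemma walk_edges:
  "W = s @ u @ t \<Longrightarrow> walk (edges W f) (f (length s)) (embed u) (f (length s + length u))"
proof (induction u arbitrary: s)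
  case (Cons x u)
  have "walk (edges W f) (f (length (s @ [x]))) (embed u) (f (length (s @ [x]) + length u))"
    by (rule Cons.IH) (simp add: Cons.prems)
  moreover have "(f (length s), x, f (Suc (length s))) \<in> edges W f"
    unfolding edges_def by (rule image_eqI[of _ _ "length s"]) (simp_all add: Cons.prems)
  ultimately show ?case by auto
qed simp

text \<open>
  One folding step: \<open>r\<close> is identified with \<open>q\<close>. Two distinct edges become equal, so the number
  of edges drops by at least one, while the number of vertices drops by exactly one.
\<close>

lemma merge_vertices:
  fixes f :: "nat \<Rightarrow> 'v"
  assumes "q \<in> f ` {..length W}" "r \<in> f ` {..length W}" "q \<noteq> r"
    and e: "(a, x, b) \<in> edges W f" "(a', x, b') \<in> edges W f" "(a, x, b) \<noteq> (a', x, b')"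
    and eq: "(id(r := q)) a = (id(r := q)) a'" "(id(r := q)) b = (id(r := q)) b'"
  shows "card (edges W (id(r := q) \<circ> f)) < card (edges W f)"
    and "Suc (card ((id(r := q) \<circ> f) ` {..length W})) = card (f ` {..length W})"
proof -
  let ?g = "id(r := q)" and ?V = "f ` {..length W}"
  let ?h = "\<lambda>(a, x, b). (?g a, x, ?g b)"
  have "edges W (?g \<circ> f) = ?h ` edges W f"
    by (auto simp: edges_def image_iff)
  also have "\<dots> = ?h ` (edges W f - {(a', x, b')})"
  proof -
    have "?h (a', x, b') \<in> ?h ` (edges W f - {(a', x, b')})"
      using e eq by (intro image_eqI[of _ _ "(a, x, b)"]) auto
    then show ?thesis by blast
  qed
  finally have "card (edges W (?g \<circ> f)) \<le> card (edges W f - {(a', x, b')})"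
    by (simp add: card_image_le)
  also have "\<dots> < card (edges W f)"
    using e(2) by (intro card_Diff1_less) simp_all
  finally show "card (edges W (?g \<circ> f)) < card (edges W f)" .
  have "(?g \<circ> f) ` {..length W} = ?g ` ?V"
    by (rule image_comp[symmetric])
  also have "\<dots> = ?V - {r}"
    using assms(1,3) by auto
  finally show "Suc (card ((?g \<circ> f) ` {..length W})) = card ?V"
    using assms(2) by (simp only:) (rule card_Suc_Diff1; simp)
qed

lemma change_of_truth:
  fixes a b :: nat
  assumes "a \<le> b" "P a" "\<not> P b"
  shows "\<exists>i. a \<le> i \<and> i < b \<and> P i \<and> \<not> P (Suc i)"
  using assms by (induction rule: dec_induct) (auto simp: less_Suc_eq)

abbreviation rose_word :: "(letter list \<Rightarrow> letter list) \<Rightarrow> letter list" where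
  "rose_word \<sigma> \<equiv> \<sigma> [La] @ \<sigma> [Lb] @ \<sigma> [Lc]"

text \<open>
  The first three equations close the petals at the common base point \<open>f 0\<close>. The last condition
  bounds the rank of the fundamental group by three. At least two vertices are demanded so that
  a quotient with the fewest vertices is the last stage before the folding is complete.
\<close>

definition rose_quotient :: "(letter list \<Rightarrow> letter list) \<Rightarrow> (nat \<Rightarrow> nat) \<Rightarrow> bool" where
  "rose_quotient \<sigma> f \<longleftrightarrow>
     f (length (\<sigma> [La])) = f 0 \<and> f (length (\<sigma> [La]) + length (\<sigma> [Lb])) = f 0 \<and>
     f (length (rose_word \<sigma>)) = f 0 \<and>
     2 \<le> card (f ` {..length (rose_word \<sigma>)}) \<and>
     card (edges (rose_word \<sigma>) f) \<le> card (f ` {..length (rose_word \<sigma>)}) + 2"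

lemma rose_quotient_walk:
  assumes "rose_quotient \<sigma> f"
  shows "walk (edges (rose_word \<sigma>) f) (f 0) (embed (\<sigma> [x])) (f 0)"
proof (cases x)
  case La
  then show ?thesis
    using walk_edges[of "rose_word \<sigma>" "[]" "\<sigma> [La]" _ f] assms by (simp add: rose_quotient_def)
next
  case Lb
  then show ?thesis
    using walk_edges[of "rose_word \<sigma>" "\<sigma> [La]" "\<sigma> [Lb]" _ f] assms
    by (simp add: rose_quotient_def)
next
  case Lc
  then show ?thesis
    using walk_edges[of "rose_word \<sigma>" "\<sigma> [La] @ \<sigma> [Lb]" "\<sigma> [Lc]" "[]" f] assms
    by (simp add: rose_quotient_def add.assoc)
qed

lemma rose_quotient_exists:
  assumes "\<And>x. \<sigma> [x] \<noteq> []" and N: "3 < length (rose_word \<sigma>)"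
  shows "\<exists>f. rose_quotient \<sigma> f"
proof -
  let ?N = "length (rose_word \<sigma>)"
  let ?B = "{length (\<sigma> [La]), length (\<sigma> [La]) + length (\<sigma> [Lb]), ?N}"
  \<comment> \<open>The rose itself: only the ends of the petals are identified.\<close>
  define f where "f i = (if i \<in> ?B then 0 else i)" for i
  have pos: "0 < length (\<sigma> [x])" for x
    using assms(1) by simp
  have "card ?B = 3"
    using pos[of La] pos[of Lb] pos[of Lc] by simp
  moreover have V: "f ` {..?N} = {..?N} - ?B"
  proof -
    have "0 \<notin> ?B" using pos[of La] by simp
    then show ?thesis by (auto simp: f_def)
  qed
  moreover have "?B \<subseteq> {..?N}" by auto
  ultimately have "card (f ` {..?N}) = Suc ?N - 3"
    by (simp only: card_Diff_subset finite.intros card_atMost)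
  moreover have "card (edges (rose_word \<sigma>) f) \<le> ?N"
    unfolding edges_def by (rule order_trans[OF card_image_le]) auto
  ultimately have "rose_quotient \<sigma> f"
    using N unfolding rose_quotient_def
    by (intro conjI) (simp_all add: f_def del: length_append)
  then show ?thesis by blast
qed

text \<open>
  In a folded quotient, each letter labels a loop at the base point, because it is the reduced
  form of a product of closed walks and their inverses. Since no other edge can leave the base
  point, the graph collapses to one vertex.
\<close>

lemma rose_quotient_not_folded:
  assumes \<sigma>: "invertible_substitution \<sigma>" and f: "rose_quotient \<sigma> f"
  shows "\<not> folded (edges (rose_word \<sigma>) f)"
proof
  let ?E = "edges (rose_word \<sigma>) f" and ?N = "length (rose_word \<sigma>)"
  assume folded: "folded ?E"
  have loop: "(f 0, x, f 0) \<in> ?E" for x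
  proof -
    obtain w where "free_extension \<sigma> w = [(x, True)]"
      using free_extension_surj[OF \<sigma>] by blast
    with walk_free_extension[of ?E "f 0" \<sigma> w, OF folded rose_quotient_walk[OF f]]
    show ?thesis by simp
  qed
  have "i \<le> ?N \<Longrightarrow> f i = f 0" for i
  proof (induction i)
    case (Suc i)
    then have "(f i, rose_word \<sigma> ! i, f (Suc i)) \<in> ?E"
      unfolding edges_def by (intro image_eqI[of _ _ i]) auto
    moreover have "f i = f 0" using Suc by simp
    ultimately show ?case
      using loop[of "rose_word \<sigma> ! i"] folded unfolding folded_def by metis
  qed simp
  then have "f ` {..?N} \<subseteq> {f 0}" by blast
  then have "card (f ` {..?N}) \<le> 1"
    using card_mono[of "{f 0}"] by fastforce
  with f show False by (simp add: rose_quotient_def)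
qed

lemma rose_quotient_fold:
  assumes f: "rose_quotient \<sigma> f" and nf: "\<not> folded (edges (rose_word \<sigma>) f)"
    and big: "2 < card (f ` {..length (rose_word \<sigma>)})"
  shows "\<exists>g. rose_quotient \<sigma> g \<and>
     card (g ` {..length (rose_word \<sigma>)}) < card (f ` {..length (rose_word \<sigma>)})"
proof -
  let ?W = "rose_word \<sigma>"
  let ?N = "length ?W"
  have V: "a \<in> f ` {..?N} \<and> b \<in> f ` {..?N}" if "(a, x, b) \<in> edges ?W f" for a x b
    using that by (auto simp: edges_def)
  obtain q r where qr: "q \<in> f ` {..?N}" "r \<in> f ` {..?N}"
    and less: "card (edges ?W (id(r := q) \<circ> f)) < card (edges ?W f)"
    and Suc: "Suc (card ((id(r := q) \<circ> f) ` {..?N})) = card (f ` {..?N})"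
  proof -
    from nf consider
      s x t t' where "(s, x, t) \<in> edges ?W f" "(s, x, t') \<in> edges ?W f" "t \<noteq> t'"
    | s s' x t where "(s, x, t) \<in> edges ?W f" "(s', x, t) \<in> edges ?W f" "s \<noteq> s'"
      unfolding folded_def by blast
    then show ?thesis
    proof cases
      case 1
      then show ?thesis
        using that[of t t'] V merge_vertices[of t f ?W t' s x t s t'] by auto
    next
      case 2
      then show ?thesis
        using that[of s s'] V merge_vertices[of s f ?W s' s x t s' t] by auto
    qed
  qed
  have "rose_quotient \<sigma> (id(r := q) \<circ> f)"
    unfolding rose_quotient_def
  proof (intro conjI)
    show "2 \<le> card ((id(r := q) \<circ> f) ` {..?N})" using Suc big by linarith
    show "card (edges ?W (id(r := q) \<circ> f)) \<le> card ((id(r := q) \<circ> f) ` {..?N}) + 2"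
      using less Suc f unfolding rose_quotient_def by linarith
  qed (use f in \<open>simp_all only: rose_quotient_def comp_apply\<close>)
  then show ?thesis using Suc by (metis lessI)
qed

text \<open>
  A quotient of the rose with the fewest vertices is still not folded, hence one more folding
  would apply if it had more than two vertices. The edges in both directions exist because the
  closed walk through all petals starts and ends at \<open>b\<close> and visits \<open>q\<close>.
\<close>

lemma two_vertex_quotient:
  assumes \<sigma>: "invertible_substitution \<sigma>" and N: "3 < length (rose_word \<sigma>)"
  obtains E :: "(nat \<times> letter \<times> nat) set" and b q where
    "b \<noteq> q" "E \<subseteq> {b, q} \<times> UNIV \<times> {b, q}" "card E \<le> 4" "\<not> folded E"
    "\<exists>x. (b, x, q) \<in> E" "\<exists>x. (q, x, b) \<in> E"
    "\<And>x. walk E b (embed (\<sigma> [x])) b"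
proof -
  let ?W = "rose_word \<sigma>"
  let ?N = "length ?W"
  obtain f where f: "rose_quotient \<sigma> f"
    and least: "\<And>g. rose_quotient \<sigma> g \<Longrightarrow> card (f ` {..?N}) \<le> card (g ` {..?N})"
    using rose_quotient_exists[OF invertible_image_nonempty[OF \<sigma>] N]
      ex_has_least_nat[of "rose_quotient \<sigma>" _ "\<lambda>f. card (f ` {..?N})"] by blast
  let ?E = "edges ?W f"
  have nf: "\<not> folded ?E"
    by (rule rose_quotient_not_folded[OF \<sigma> f])
  have "card (f ` {..?N}) = 2"
    using rose_quotient_fold[OF f nf] least f unfolding rose_quotient_def
    by (metis le_antisym linorder_not_le)
  then obtain v v' where v: "f ` {..?N} = {v, v'}" "v \<noteq> v'"
    unfolding card_2_iff by blast
  moreover have "f 0 \<in> f ` {..?N}" by simp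
  ultimately have "f 0 = v \<or> f 0 = v'" by blast
  then obtain q where q: "q \<noteq> f 0" "f ` {..?N} = {f 0, q}"
    using v by (metis insert_commute)
  then have "q \<in> f ` {..?N}" by simp
  then obtain j where j: "j \<le> ?N" "f j = q" by auto
  have fN: "f ?N = f 0"
    using f unfolding rose_quotient_def by blast
  have edge: "(f i, ?W ! i, f (Suc i)) \<in> ?E" "f i \<in> {f 0, q}" "f (Suc i) \<in> {f 0, q}"
    if "i < ?N" for i
    using that q(2) unfolding edges_def by auto
  show ?thesis
  proof (rule that[of "f 0" q ?E])
    show "f 0 \<noteq> q" using q by simp
    show "?E \<subseteq> {f 0, q} \<times> UNIV \<times> {f 0, q}"
      using edge(2,3) by (auto simp: edges_def)
    show "card ?E \<le> 4"
      using f \<open>card (f ` {..?N}) = 2\<close> unfolding rose_quotient_def by linarith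
    show "\<exists>x. (f 0, x, q) \<in> ?E"
    proof -
      from change_of_truth[of 0 j "\<lambda>i. f i = f 0"] j q(1) obtain i
        where "i < j" "f i = f 0" "f (Suc i) \<noteq> f 0" by auto
      with edge[of i] j(1) show ?thesis by auto
    qed
    show "\<exists>x. (q, x, f 0) \<in> ?E"
    proof -
      from change_of_truth[of j ?N "\<lambda>i. f i \<noteq> f 0"] j q(1) fN obtain i
        where "i < ?N" "f i \<noteq> f 0" "f (Suc i) = f 0" by auto
      with edge[of i] show ?thesis by auto
    qed
  qed (use nf rose_quotient_walk[OF f] in auto)
qed

section \<open>Graphs with two vertices\<close>

text \<open>
  The graph version of the statement that \<open>k\<close> is the only letter that can be read after \<open>l\<close>.
\<close>

definition followed :: "('v \<times> 'a \<times> 'v) set \<Rightarrow> 'a \<Rightarrow> 'a \<Rightarrow> bool" where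
  "followed E l k \<longleftrightarrow> (\<forall>u v w j. (u, l, v) \<in> E \<longrightarrow> (v, j, w) \<in> E \<longrightarrow> j = k)"

definition reversal :: "('v \<times> 'a \<times> 'v) set \<Rightarrow> ('v \<times> 'a \<times> 'v) set" where
  "reversal E = {(t, x, s). (s, x, t) \<in> E}"

lemma in_reversal [simp]: "(t, x, s) \<in> reversal E \<longleftrightarrow> (s, x, t) \<in> E"
  by (simp add: reversal_def)

lemma reversal_reversal [simp]: "reversal (reversal E) = E"
  by (auto simp: reversal_def)

lemma card_reversal [simp]: "card (reversal E) = card E"
proof -
  have "reversal E = (\<lambda>(s, x, t). (t, x, s)) ` E"
    by (force simp: reversal_def)
  then show ?thesis
    by (simp only:) (rule card_image, auto simp: inj_on_def)
qed

lemma third_letter: "\<exists>z :: letter. z \<noteq> x \<and> z \<noteq> y"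
  by (cases x; cases y) auto

lemma finite_UNIV_letter: "finite (UNIV :: letter set)"
  by (rule finite_subset[of _ "{La, Lb, Lc}"]) (use letter.exhaust in auto)

text \<open>
  The four edges that are known to exist are all the edges, so each of the two letters other than
  \<open>x\<close> labels one edge only. The letter \<open>y\<close> leads from \<open>q\<close> to \<open>p\<close>; the four positions
  of the remaining edge are checked separately.
\<close>

lemma two_vertex_fork:
  fixes E :: "('v \<times> letter \<times> 'v) set"
  assumes "p \<noteq> q" and E: "E \<subseteq> {p, q} \<times> UNIV \<times> {p, q}" and card: "card E \<le> 4"
    and fork: "(p, x, p) \<in> E" "(p, x, q) \<in> E"
    and exit: "(q, y, p) \<in> E" and occurs: "\<And>z. \<exists>s t. (s, z, t) \<in> E"
  shows "\<exists>l k. l \<noteq> k \<and> (followed E l k \<or> followed (reversal E) l k)"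
proof -
  have "finite E"
    by (rule finite_subset[OF E]) (simp add: finite_UNIV_letter)
  have "x \<noteq> y"
  proof
    assume "x = y"
    obtain u v :: letter where uv: "u \<noteq> x" "v \<noteq> x" "u \<noteq> v"
      by (cases x) auto
    obtain s t s' t' where st: "(s, u, t) \<in> E" "(s', v, t') \<in> E"
      using occurs by meson
    \<comment> \<open>Three edges for \<open>x\<close> and one for each of the other letters are too many.\<close>
    have "card {(p, x, p), (p, x, q), (q, x, p), (s, u, t), (s', v, t')} \<le> card E"
      by (rule card_mono[OF \<open>finite E\<close>]) (use fork exit \<open>x = y\<close> st in auto)
    with card uv \<open>p \<noteq> q\<close> show False by simp
  qed
  obtain z where z: "z \<noteq> x" "z \<noteq> y"
    using third_letter by blast
  obtain s t where st: "(s, z, t) \<in> E"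
    using occurs by blast
  have "{(p, x, p), (p, x, q), (q, y, p), (s, z, t)} = E"
    by (rule card_seteq[OF \<open>finite E\<close>]) (use assms \<open>x \<noteq> y\<close> z st in auto)
  note E_eq = this[symmetric]
  have "s = p \<or> s = q" "t = p \<or> t = q"
    using E st by auto
  then consider "s = p" "t = p" | "s = p" "t = q" | "s = q" "t = p" | "s = q" "t = q"
    by blast
  then show ?thesis
  proof cases
    case 1
    then have "followed (reversal E) y x"
      using \<open>p \<noteq> q\<close> \<open>x \<noteq> y\<close> z by (auto simp: E_eq followed_def)
    then show ?thesis using \<open>x \<noteq> y\<close> by metis
  next
    case 2
    then have "followed E z y"
      using \<open>p \<noteq> q\<close> \<open>x \<noteq> y\<close> z by (auto simp: E_eq followed_def)
    then show ?thesis using z by metis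
  next
    case 3
    then have "followed (reversal E) y x"
      using \<open>p \<noteq> q\<close> \<open>x \<noteq> y\<close> z by (auto simp: E_eq followed_def)
    then show ?thesis using \<open>x \<noteq> y\<close> by metis
  next
    case 4
    then have "followed E y x"
      using \<open>p \<noteq> q\<close> \<open>x \<noteq> y\<close> z by (auto simp: E_eq followed_def)
    then show ?thesis using \<open>x \<noteq> y\<close> by metis
  qed
qed

lemma two_vertex_out_fork:
  fixes E :: "('v \<times> letter \<times> 'v) set"
  assumes "p \<noteq> q" and E: "E \<subseteq> {p, q} \<times> UNIV \<times> {p, q}" and card: "card E \<le> 4"
    and fork: "(s, x, t) \<in> E" "(s, x, t') \<in> E" "t \<noteq> t'"
    and to_q: "\<exists>x. (p, x, q) \<in> E" and from_q: "\<exists>x. (q, x, p) \<in> E"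
    and occurs: "\<And>z. \<exists>s t. (s, z, t) \<in> E"
  shows "\<exists>l k. l \<noteq> k \<and> (followed E l k \<or> followed (reversal E) l k)"
proof -
  have "s = p \<or> s = q" "{t, t'} = {p, q}"
    using E fork by auto
  then consider "(p, x, p) \<in> E" "(p, x, q) \<in> E" | "(q, x, q) \<in> E" "(q, x, p) \<in> E"
    using fork by (metis doubleton_eq_iff)
  then show ?thesis
  proof cases
    case 1
    then show ?thesis
      using two_vertex_fork[OF assms(1-3)] from_q occurs by blast
  next
    case 2
    have "E \<subseteq> {q, p} \<times> UNIV \<times> {q, p}"
      using E by (simp add: insert_commute)
    from two_vertex_fork[OF assms(1)[symmetric] this card 2] to_q occurs show ?thesis by blast
  qed
qed

lemma two_vertex_followed:
  fixes E :: "('v \<times> letter \<times> 'v) set"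
  assumes "p \<noteq> q" and E: "E \<subseteq> {p, q} \<times> UNIV \<times> {p, q}" and card: "card E \<le> 4"
    and nf: "\<not> folded E"
    and to_q: "\<exists>x. (p, x, q) \<in> E" and from_q: "\<exists>x. (q, x, p) \<in> E"
    and occurs: "\<And>z. \<exists>s t. (s, z, t) \<in> E"
  shows "\<exists>l k. l \<noteq> k \<and> (followed E l k \<or> followed (reversal E) l k)"
proof -
  from nf consider
    s x t t' where "(s, x, t) \<in> E" "(s, x, t') \<in> E" "t \<noteq> t'"
  | s s' x t where "(s, x, t) \<in> E" "(s', x, t) \<in> E" "s \<noteq> s'"
    unfolding folded_def by blast
  then show ?thesis
  proof cases
    case 1
    then show ?thesis
      by (rule two_vertex_out_fork[OF assms(1-3) _ _ _ to_q from_q occurs])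
  next
    case 2
    have "\<exists>l k. l \<noteq> k \<and> (followed (reversal E) l k \<or> followed (reversal (reversal E)) l k)"
    proof (rule two_vertex_out_fork[OF assms(1)])
      show "(t, x, s) \<in> reversal E" "(t, x, s') \<in> reversal E" "s \<noteq> s'"
        using 2 by simp_all
      show "reversal E \<subseteq> {p, q} \<times> UNIV \<times> {p, q}"
        using E by (auto simp: reversal_def)
      show "\<exists>a b. (a, z, b) \<in> reversal E" for z
        using occurs[of z] by auto
    qed (use card to_q from_q in auto)
    then show ?thesis by auto
  qed
qed

section \<open>Peeling off a letter\<close>

text \<open>
  A final \<open>l\<close> is excluded as well: for \<open>l \<noteq> k\<close> these words are
  exactly the images of \<open>append_letter l k\<close>.
\<close>

fun always_followed :: "'a \<Rightarrow> 'a \<Rightarrow> 'a list \<Rightarrow> bool" where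
  "always_followed l k [] \<longleftrightarrow> True"
| "always_followed l k (x # w) \<longleftrightarrow> (x = l \<longrightarrow> (\<exists>v. w = k # v)) \<and> always_followed l k w"

lemma always_followed_append_letter:
  "l \<noteq> k \<Longrightarrow> always_followed l k w \<Longrightarrow> \<exists>v. w = append_letter l k v"
proof (induction w rule: length_induct)
  case (1 w)
  show ?case
  proof (cases w)
    case Nil
    then show ?thesis by (metis append_letter_Nil)
  next
    case (Cons x w')
    show ?thesis
    proof (cases "x = l")
      case True
      with 1 Cons obtain w'' where w'': "w' = k # w''" "always_followed l k w''" by auto
      with 1 Cons obtain v where "w'' = append_letter l k v" by fastforce
      with Cons True w'' have "w = append_letter l k (l # v)" by simp
      then show ?thesis ..
    next
      case False
      with 1 Cons obtain v where "w' = append_letter l k v" by fastforce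
      with Cons False have "w = append_letter l k (x # v)" by simp
      then show ?thesis ..
    qed
  qed
qed

lemma always_followed_walk:
  "walk E v (embed u) v' \<Longrightarrow> followed E l k \<Longrightarrow> u = [] \<or> last u \<noteq> l \<Longrightarrow> always_followed l k u"
proof (induction u arbitrary: v)
  case (Cons x u)
  from Cons.prems obtain m where m: "(v, x, m) \<in> E" "walk E m (embed u) v'" by auto
  have "always_followed l k u"
    using Cons.IH[OF m(2)] Cons.prems by (auto split: if_splits)
  moreover have "\<exists>w. u = k # w" if "x = l"
  proof -
    from that Cons.prems obtain j w where "u = j # w" by (cases u) auto
    with m that Cons.prems(2) show ?thesis by (auto simp: followed_def)
  qed
  ultimately show ?case by simp
qed simp

text \<open>
  A word can violate the conclusion only by ending in \<open>l\<close>. Then the base point is a target of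
  \<open>l\<close>, so nothing but \<open>k\<close> leaves it, and all the words start with \<open>k\<close>. Rotating this \<open>k\<close> to the
  end turns the words into closed walks based elsewhere, none of which ends in \<open>l\<close>.
\<close>

lemma closed_walks_always_followed:
  assumes ne: "\<And>x. u x \<noteq> []" and walk: "\<And>x. walk E b (embed (u x)) b"
    and E: "followed E l k" and "l \<noteq> k"
  shows "(\<forall>x. always_followed l k (u x)) \<or>
    (\<exists>t. \<forall>x. u x = k # t x \<and> always_followed l k (t x @ [k]))"
proof (cases "\<exists>x. last (u x) = l")
  case False
  then show ?thesis
    using always_followed_walk[OF walk E] by blast
next
  case True
  then obtain x0 w0 where "u x0 = w0 @ [l]"
    using ne by (metis append_butlast_last_id)
  with walk[of x0] obtain v where v: "(v, l, b) \<in> E"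
    by (auto simp: embed_append walk_append)
  have "\<exists>t. u x = k # t \<and> always_followed l k (t @ [k])" for x
  proof -
    obtain j t where u: "u x = j # t"
      using ne by (metis list.exhaust)
    with walk[of x] obtain m where m: "(b, j, m) \<in> E" "walk E m (embed t) b" by auto
    then have "j = k"
      using v E unfolding followed_def by blast
    moreover have "walk E m (embed (t @ [k])) m"
      using m \<open>j = k\<close> by (auto simp: embed_append walk_append)
    then have "always_followed l k (t @ [k])"
      using always_followed_walk[OF _ E] \<open>l \<noteq> k\<close> by fastforce
    ultimately show ?thesis using u by simp
  qed
  then show ?thesis by metis
qed

lemma walk_reversal: "walk E v (embed u) v' \<Longrightarrow> walk (reversal E) v' (embed (rev u)) v"
proof (induction u arbitrary: v)
  case (Cons x u)
  then show ?case by (auto simp: embed_append walk_append)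
qed simp

definition total_length :: "(letter list \<Rightarrow> letter list) \<Rightarrow> nat" where
  "total_length \<sigma> = length (\<sigma> [La]) + length (\<sigma> [Lb]) + length (\<sigma> [Lc])"

text \<open>
  The conjugate \<open>\<tau>\<close> of \<open>\<sigma>\<close> factors through \<open>\<phi>\<close>. The other factor is strictly shorter, because
  \<open>l\<close> occurs in one of its images and \<open>\<phi>\<close> lengthens every word that contains \<open>l\<close>. Comparing
  multisets of letters forgets the rotation but retains both the matrix and the lengths.
\<close>

lemma factor_after_conjugation:
  assumes \<sigma>: "invertible_substitution \<sigma>" and \<tau>: "substitution \<tau>"
    and conj: "(\<forall>x. \<sigma> [x] @ [k] = k # \<tau> [x]) \<or> (\<forall>x. \<tau> [x] @ [k] = k # \<sigma> [x]) \<or> \<tau> = \<sigma>"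
    and "l \<noteq> k" and \<phi>: "\<phi> \<in> {append_letter l k, prepend_letter l k}"
    and range: "\<And>x. \<exists>w. \<tau> [x] = \<phi> w"
  shows "\<exists>\<rho>. invertible_substitution \<rho> \<and> total_length \<rho> < total_length \<sigma> \<and>
    (\<forall>x. mset (\<sigma> [x]) = mset ((\<phi> \<circ> \<rho>) [x]))"
proof -
  have \<sigma>': "substitution \<sigma>"
    using \<sigma> by (simp add: invertible_iff_bij_betw)
  have "invertible_substitution \<tau>"
    using conj \<sigma> invertible_conjugate_iff[OF \<sigma>' \<tau>] invertible_conjugate_iff[OF \<tau> \<sigma>'] by blast
  have \<phi>_sub: "substitution \<phi>" and \<phi>_inv: "invertible_substitution \<phi>"
    using \<phi> \<open>l \<noteq> k\<close> by (auto simp: substitution_append_letter substitution_prepend_letter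
        invertible_append_letter invertible_prepend_letter)
  obtain g where g: "\<tau> [x] = \<phi> (g x)" for x
    using range by metis
  define \<rho> where "\<rho> w = concat (map g w)" for w
  have \<rho>: "substitution \<rho>"
    unfolding \<rho>_def[abs_def] by (rule substitution_concat_map)
  have \<tau>_eq: "\<tau> = \<phi> \<circ> \<rho>"
    by (rule substitution_eqI[OF \<tau> substitution_comp[OF \<phi>_sub \<rho>]]) (simp add: g \<rho>_def)
  have inv: "invertible_substitution \<rho>"
    using invertible_substitution_cancel_left[OF \<phi>_inv \<rho>] \<open>invertible_substitution \<tau>\<close> \<tau>_eq by simp
  have rotate: "mset u = mset v" if "u @ [k] = k # v" for u v
    using arg_cong[OF that, of mset] by simp
  have mset: "mset (\<sigma> [x]) = mset (\<tau> [x])" for x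
    using conj rotate by metis
  have len: "length w + (if l \<in> set w then 1 else 0) \<le> length (\<phi> w)" for w
  proof -
    have "length w + (if l \<in> set w then 1 else 0) \<le> length (append_letter l k w)"
         "length w + (if l \<in> set w then 1 else 0) \<le> length (prepend_letter l k w)"
      by (induction w) auto
    then show ?thesis using \<phi> by auto
  qed
  obtain y where y: "l \<in> set (\<rho> [y])"
    using invertible_letter_occurs[OF inv] by blast
  have "length (\<sigma> [x]) = length (\<phi> (\<rho> [x]))" for x
    using arg_cong[OF mset[of x], of size] by (simp add: \<tau>_eq)
  then have "total_length \<rho> < total_length \<sigma>"
    using len[of "\<rho> [La]"] len[of "\<rho> [Lb]"] len[of "\<rho> [Lc]"] y
    by (cases y) (auto simp: total_length_def split: if_splits)
  with inv mset show ?thesis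
    unfolding \<tau>_eq by blast
qed

lemma peel_letter:
  assumes \<sigma>: "invertible_substitution \<sigma>" and N: "3 < total_length \<sigma>"
  shows "\<exists>l k \<phi> \<rho>. l \<noteq> k \<and> \<phi> \<in> {append_letter l k, prepend_letter l k} \<and>
    invertible_substitution \<rho> \<and> total_length \<rho> < total_length \<sigma> \<and>
    (\<forall>x. mset (\<sigma> [x]) = mset ((\<phi> \<circ> \<rho>) [x]))"
proof -
  have sub: "substitution \<sigma>"
    using \<sigma> by (simp add: invertible_iff_bij_betw)
  have ne: "\<sigma> [x] \<noteq> []" for x
    by (rule invertible_image_nonempty[OF \<sigma>])
  from N have "3 < length (rose_word \<sigma>)" by (simp add: total_length_def)
  then obtain E :: "(nat \<times> letter \<times> nat) set" and b q where E:
    "b \<noteq> q" "E \<subseteq> {b, q} \<times> UNIV \<times> {b, q}" "card E \<le> 4" "\<not> folded E"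
    "\<exists>x. (b, x, q) \<in> E" "\<exists>x. (q, x, b) \<in> E"
    and walk: "\<And>x. walk E b (embed (\<sigma> [x])) b"
    using two_vertex_quotient[OF \<sigma>] by metis
  have "\<exists>s t. (s, z, t) \<in> E" for z
  proof -
    obtain y where "z \<in> set (\<sigma> [y])"
      using invertible_letter_occurs[OF \<sigma>] by blast
    then obtain u v where "\<sigma> [y] = u @ z # v"
      by (meson split_list)
    with walk[of y] show ?thesis by (auto simp: embed_append walk_append)
  qed
  then obtain l k where "l \<noteq> k" and lk: "followed E l k \<or> followed (reversal E) l k"
    using two_vertex_followed[OF E] by blast
  note factor = factor_after_conjugation[OF \<sigma> _ _ \<open>l \<noteq> k\<close>]
  note range = always_followed_append_letter[OF \<open>l \<noteq> k\<close>]
  have range': "\<exists>v. w = prepend_letter l k v" if "always_followed l k (rev w)" for w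
    using range[OF that] by (metis rev_append_letter rev_rev_ident)
  \<comment> \<open>Reversing graph and words turns the case of predecessors into that of successors.\<close>
  from lk consider
    "\<And>x. always_followed l k (\<sigma> [x])"
  | t where "\<And>x. \<sigma> [x] = k # t x" "\<And>x. always_followed l k (t x @ [k])"
  | "\<And>x. always_followed l k (rev (\<sigma> [x]))"
  | t where "\<And>x. rev (\<sigma> [x]) = k # t x" "\<And>x. always_followed l k (t x @ [k])"
    using closed_walks_always_followed[of "\<lambda>x. \<sigma> [x]", OF ne walk _ \<open>l \<noteq> k\<close>]
      closed_walks_always_followed[of "\<lambda>x. rev (\<sigma> [x])", OF _ walk_reversal[OF walk] _ \<open>l \<noteq> k\<close>] ne
    by (metis rev_is_Nil_conv)
  then have "\<exists>\<phi> \<in> {append_letter l k, prepend_letter l k}. \<exists>\<rho>.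
    invertible_substitution \<rho> \<and> total_length \<rho> < total_length \<sigma> \<and>
    (\<forall>x. mset (\<sigma> [x]) = mset ((\<phi> \<circ> \<rho>) [x]))"
  proof cases
    case 1
    show ?thesis
      using factor[OF sub, of "append_letter l k"] range[OF 1] by blast
  next
    case 2
    show ?thesis
      using factor[OF substitution_concat_map[of "\<lambda>x. t x @ [k]"], of "append_letter l k"]
        range[OF 2(2)] 2(1) by auto
  next
    case 3
    show ?thesis
      using factor[OF sub, of "prepend_letter l k"] range'[OF 3] by blast
  next
    case 4
    have "\<sigma> [x] = rev (t x) @ [k]" for x
      using 4(1)[of x] by (metis rev.simps(2) rev_rev_ident)
    moreover have "\<exists>v. k # rev (t x) = prepend_letter l k v" for x
      using range'[of "k # rev (t x)"] 4(2) by simp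
    ultimately show ?thesis
      using factor[OF substitution_concat_map[of "\<lambda>x. k # rev (t x)"], of "prepend_letter l k"]
      by auto
  qed
  with \<open>l \<noteq> k\<close> show ?thesis by blast
qed

section \<open>Elementary substitutions and their matrices\<close>

lemma subst_matrix_cong:
  assumes "\<And>x. mset (\<sigma> [x]) = mset (\<tau> [x])"
  shows "subst_matrix \<sigma> = subst_matrix \<tau>"
proof -
  have "count_list (\<sigma> [x]) y = count_list (\<tau> [x]) y" for x y
    using assms[of x] by (metis count_mset)
  then show ?thesis by (simp add: subst_matrix_def)
qed

lemma count_list_substitution:
  assumes "substitution \<sigma>"
  shows "count_list (\<sigma> w) y = count_list (\<sigma> [La]) y * count_list w La +
    count_list (\<sigma> [Lb]) y * count_list w Lb + count_list (\<sigma> [Lc]) y * count_list w Lc"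
proof (induction w)
  case (Cons x w)
  then show ?case
    by (cases x) (simp_all add: substitution_Cons[OF assms, of _ w])
qed (simp add: substitution_Nil assms)

lemma subst_matrix_comp:
  assumes "substitution \<sigma>"
  shows "subst_matrix (\<sigma> \<circ> \<tau>) = subst_matrix \<sigma> ** subst_matrix \<tau>"
  using count_list_substitution[OF assms, of "\<tau> [La]"] count_list_substitution[OF assms, of "\<tau> [Lb]"]
    count_list_substitution[OF assms, of "\<tau> [Lc]"]
  by (simp add: vec_eq_iff forall_3 matrix_matrix_mult_def sum_3 subst_matrix_def)

lemma subst_matrix_id: "subst_matrix id = mat 1"
  by (simp add: vec_eq_iff forall_3 subst_matrix_def mat_def)

lemma phi_l_eq: "phi_l = prepend_letter La Lb"
  by (rule substitution_eqI)
    (auto simp: phi_l_def substitution_triple substitution_prepend_letter triple_def split: letter.split)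

lemma phi_r_eq: "phi_r = append_letter La Lb"
  by (rule substitution_eqI)
    (auto simp: phi_r_def substitution_triple substitution_append_letter triple_def split: letter.split)

lemma relabel_append_letter: "inj p \<Longrightarrow> append_letter (p l) (p k) (map p w) = map p (append_letter l k w)"
  by (induction w) (auto dest: injD)

lemma relabel_prepend_letter: "inj p \<Longrightarrow> prepend_letter (p l) (p k) (map p w) = map p (prepend_letter l k w)"
  by (induction w) (auto dest: injD)

lemma bij_letterI: "inj p \<Longrightarrow> bij p" for p :: "letter \<Rightarrow> letter"
  by (simp add: bij_def finite_UNIV_inj_surj finite_UNIV_letter)

text \<open>
  Renaming \<open>l\<close> and \<open>k\<close> to \<open>a\<close> and \<open>b\<close> by a permutation turns \<open>\<phi>\<close> into \<open>phi_r\<close> or \<open>phi_l\<close>.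
\<close>

lemma letter_attachment_fibonacci:
  assumes "l \<noteq> k" "\<phi> \<in> {append_letter l k, prepend_letter l k}"
  shows "fibonacci_substitution \<phi>"
proof -
  obtain m where m: "m \<noteq> l" "m \<noteq> k"
    using third_letter by blast
  define p where "p = case_letter l k m"
  have "inj p"
    using assms(1) m by (intro injI) (auto simp: p_def split: letter.splits)
  then have "bij p" by (rule bij_letterI)
  have p: "p La = l" "p Lb = k" by (simp_all add: p_def)
  have inv: "map p (map (inv_into UNIV p) w) = w" for w
    using \<open>bij p\<close> by (simp add: bij_is_surj surj_f_inv_f comp_def)
  have "append_letter l k = map p \<circ> phi_r \<circ> map (inv_into UNIV p)"
    using relabel_append_letter[OF \<open>inj p\<close>, of La Lb] unfolding p phi_r_eq by (metis comp_apply ext inv)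
  moreover have "prepend_letter l k = map p \<circ> phi_l \<circ> map (inv_into UNIV p)"
    using relabel_prepend_letter[OF \<open>inj p\<close>, of La Lb] unfolding p phi_l_eq by (metis comp_apply ext inv)
  moreover have "permutation_substitution (map p)" "permutation_substitution (map (inv_into UNIV p))"
    using \<open>bij p\<close> bij_imp_bij_inv unfolding permutation_substitution_def by auto
  ultimately show ?thesis
    using assms(2) unfolding fibonacci_substitution_def by blast
qed

text \<open>
  No image is empty, so each image is a single letter, and every letter occurs.
\<close>

lemma short_invertible_permutation:
  assumes \<sigma>: "invertible_substitution \<sigma>" and "total_length \<sigma> \<le> 3"
  shows "permutation_substitution \<sigma>"
proof -
  have sub: "substitution \<sigma>"
    using \<sigma> by (simp add: invertible_iff_bij_betw)
  have "length (\<sigma> [x]) > 0" for x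
    using invertible_image_nonempty[OF \<sigma>] by simp
  from this[of La] this[of Lb] this[of Lc] have "length (\<sigma> [x]) = Suc 0" for x
    using assms(2) unfolding total_length_def by (cases x; simp; linarith)
  then obtain p where p: "\<sigma> [x] = [p x]" for x
    unfolding length_Suc_conv by (metis length_0_conv)
  have "surj p"
    using invertible_letter_occurs[OF \<sigma>] unfolding p surj_def by simp
  then have "bij p"
    by (simp add: bij_def finite_UNIV_surj_inj finite_UNIV_letter)
  moreover have "\<sigma> = map p"
    by (rule substitution_eqI[OF sub substitution_map]) (simp add: p)
  ultimately show ?thesis
    unfolding permutation_substitution_def by blast
qed

lemma invertible_matrix_factors:
  assumes "invertible_substitution \<sigma>"
  shows "\<exists>Es. (\<forall>E \<in> set Es. nonneg_elementary_matrix E) \<and> subst_matrix \<sigma> = matrix_prod Es"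
  using assms
proof (induction "total_length \<sigma>" arbitrary: \<sigma> rule: less_induct)
  case less
  show ?case
  proof (cases "total_length \<sigma> \<le> 3")
    case True
    with less.prems have "nonneg_elementary_matrix (subst_matrix \<sigma>)"
      using short_invertible_permutation unfolding nonneg_elementary_matrix_def by blast
    then show ?thesis
      by (intro exI[of _ "[subst_matrix \<sigma>]"]) (simp add: matrix_prod_def del: One_nat_def)
  next
    case False
    then obtain l k \<phi> \<rho> where "l \<noteq> k" and \<phi>: "\<phi> \<in> {append_letter l k, prepend_letter l k}"
      and \<rho>: "invertible_substitution \<rho>" "total_length \<rho> < total_length \<sigma>"
      and mset: "\<And>x. mset (\<sigma> [x]) = mset ((\<phi> \<circ> \<rho>) [x])"
      using peel_letter[OF less.prems] by (metis not_le)
    from less.hyps[OF \<rho>(2,1)] obtain Es where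
      Es: "\<forall>E \<in> set Es. nonneg_elementary_matrix E" "subst_matrix \<rho> = matrix_prod Es" by blast
    have "substitution \<phi>"
      using \<phi> by (auto simp: substitution_append_letter substitution_prepend_letter)
    then have "subst_matrix \<sigma> = matrix_prod (subst_matrix \<phi> # Es)"
      using subst_matrix_cong[of \<sigma> "\<phi> \<circ> \<rho>", OF mset] Es(2)
      by (simp only: subst_matrix_comp matrix_prod_def foldr.simps comp_apply)
    moreover have "nonneg_elementary_matrix (subst_matrix \<phi>)"
      using letter_attachment_fibonacci[OF \<open>l \<noteq> k\<close> \<phi>] unfolding nonneg_elementary_matrix_def by blast
    ultimately show ?thesis
      using Es(1) by (intro exI[of _ "subst_matrix \<phi> # Es"]) simp
  qed
qed

lemma elementary_matrix_invertible:
  assumes "nonneg_elementary_matrix E"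
  shows "\<exists>\<sigma>. invertible_substitution \<sigma> \<and> E = subst_matrix \<sigma>"
proof -
  have perm: "invertible_substitution \<pi>" if "permutation_substitution \<pi>" for \<pi>
    using that invertible_substitution_permutation unfolding permutation_substitution_def by blast
  have "invertible_substitution phi_l" "invertible_substitution phi_r"
    unfolding phi_l_eq phi_r_eq by (simp_all add: invertible_append_letter invertible_prepend_letter)
  then have "invertible_substitution \<sigma>" if "fibonacci_substitution \<sigma>" for \<sigma>
    using that perm unfolding fibonacci_substitution_def
    by (auto intro!: invertible_substitution_comp)
  with assms perm show ?thesis
    unfolding nonneg_elementary_matrix_def by blast
qed

theorem theorem3p2:
  fixes M :: "nat^3^3"
  shows "(\<exists>\<sigma> :: letter list \<Rightarrow> letter list. invertible_substitution \<sigma> \<and> M = subst_matrix \<sigma>) \<longleftrightarrow>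
    (\<exists>Es. (\<forall>E \<in> set Es. nonneg_elementary_matrix E) \<and> M = matrix_prod Es)"
proof
  assume "\<exists>\<sigma> :: letter list \<Rightarrow> letter list. invertible_substitution \<sigma> \<and> M = subst_matrix \<sigma>"
  then show "\<exists>Es. (\<forall>E \<in> set Es. nonneg_elementary_matrix E) \<and> M = matrix_prod Es"
    using invertible_matrix_factors by blast
next
  assume "\<exists>Es. (\<forall>E \<in> set Es. nonneg_elementary_matrix E) \<and> M = matrix_prod Es"
  then obtain Es where "\<forall>E \<in> set Es. nonneg_elementary_matrix E" and M: "M = matrix_prod Es"
    by blast
  then have "\<exists>\<sigma>. invertible_substitution \<sigma> \<and> matrix_prod Es = subst_matrix \<sigma>"
  proof (induction Es arbitrary: M)
    case Nil
    then show ?case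
      using invertible_substitution_id subst_matrix_id unfolding matrix_prod_def by (metis foldr_Nil id_apply)
  next
    case (Cons E Es)
    from Cons.IH Cons.prems obtain \<sigma> where \<sigma>: "invertible_substitution \<sigma>"
      "matrix_prod Es = subst_matrix \<sigma>" by auto
    from Cons.prems elementary_matrix_invertible obtain \<tau> where \<tau>: "invertible_substitution \<tau>"
      "E = subst_matrix \<tau>" by (metis list.set_intros(1))
    have "matrix_prod (E # Es) = subst_matrix (\<tau> \<circ> \<sigma>)"
      using \<sigma>(2) \<tau> by (simp add: matrix_prod_def subst_matrix_comp invertible_iff_bij_betw)
    then show ?case
      using invertible_substitution_comp[OF \<tau>(1) \<sigma>(1)] by blast
  qed
  then show "\<exists>\<sigma> :: letter list \<Rightarrow> letter list. invertible_substitution \<sigma> \<and> M = subst_matrix \<sigma>"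
    using M by blast
qed

end
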